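(* Let $\mathbb{K}=\mathbb{R}$ or $\mathbb{C}$, and let $D\subset T\mathbb{K}^{15}$ be Cartan's model of $(8,15)$-distribution with its frame $X_1,\dots,X_4,Y_1,\dots,Y_4$. Then the singular velocity cone of $D$ is $$\mathrm{SVC}(D)=\Bigl\{\sum_{i=1}^4u_iX_i+\sum_{j=1}^4v_jY_j\ \Big|\ u_1v_1+u_2v_2+u_3v_3+u_4v_4=0\Bigr\}.$$
   Context: Cartan's model. On $\mathbb{K}^{15}$ with coordinates $z$, $x_1,\dots,x_4$, $y_1,\dots,y_4$, $x_{ij}$ ($1\le i<j\le4$), consider the $1$-forms $\omega=dz-\sum_{i=1}^4y_i\,dx_i$ and $\omega_{ij}=dx_{ij}-(x_i\,dx_j-x_j\,dx_i+y_h\,dy_k-y_k\,dy_h)$ for $1\le i<j\le4$, where $(i,j,h,k)$ is an even permutation of $(1,2,3,4)$. Let $Z,X_{ij},X_i,Y_j$ be the frame of $T\mathbb{K}^{15}$ dual to $\omega,\omega_{ij},dx_i,dy_j$. $D$ is the rank $8$ distribution generated by $X_1,\dots,X_4,Y_1,\dots,Y_4$. Singular curves. All is $C^\infty$ for $\mathbb{K}=\mathbb{R}$ and holomorphic for $\mathbb{K}=\mathbb{C}$. For a distribution $D\subset TM$ with frame $\xi_1,\dots,\xi_r$, put $H_{\xi_i}(x,p)=\langle p,\xi_i(x)\rangle$ on $T^*M$ and $H=\sum_iu_iH_{\xi_i}$. An abnormal bi-extremal is a (Lipschitz if $\mathbb{K}=\mathbb{R}$, holomorphic if $\mathbb{K}=\mathbb{C}$)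 curve $(x(t),p(t))$ in $T^*M$ for which there is $u(t)$ with $\dot x=\partial H/\partial p$, $\dot p=-\partial H/\partial x$, $H_{\xi_1}=\dots=H_{\xi_r}=0$ and $p(t)\ne0$. A $D$-singular curve is the projection $x(t)$ of an abnormal bi-extremal (for $\mathbb{K}=\mathbb{R}$, equivalently a critical point of the endpoint map on $D$-integral curves with fixed starting point). The singular velocity cone $\mathrm{SVC}(D)\subset TM$ is the set of $v\in T_xM$, $x\in M$, such that there exists a $D$-singular curve $\gamma:(\mathbb{K},0)\to(M,x)$ with $\gamma'(0)=v$. *)

theory Defs
  imports "HOL-Analysis.Analysis"
begin

section \<open>Vector fields, Hamiltonians and singular curves on coordinate space\<close>

text \<open>
  Everything that makes sense over both base fields is stated over an arbitrary
  \<open>real_normed_field\<close> \<open>'a\<close>, to be instantiated with \<open>real\<close> and \<open>complex\<close>.  Tangent vectors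
  and covectors of \<open>'a ^ 'n\<close> are given by their components, so that the tangent and the
  cotangent bundle are both \<open>('a ^ 'n) \<times> ('a ^ 'n)\<close>.  Derivatives are taken componentwise with
  \<open>has_field_derivative\<close>, which is the real derivative for \<open>real\<close> and the complex one for
  \<open>complex\<close>.
\<close>

text \<open>The duality pairing is bilinear, unlike the inner product \<open>\<bullet>\<close> on \<open>complex ^ 'n\<close>.\<close>

definition pairing :: "'a::comm_ring_1 ^ 'n::finite \<Rightarrow> 'a ^ 'n \<Rightarrow> 'a"
  where "pairing p v = (\<Sum>k\<in>UNIV. p $ k * v $ k)"

definition partial_deriv ::
    "('a::real_normed_field ^ 'n::finite \<Rightarrow> 'a) \<Rightarrow> 'n \<Rightarrow> 'a ^ 'n \<Rightarrow> 'a"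
  where "partial_deriv f k q = deriv (\<lambda>s. f (q + s *s axis k 1)) 0"

text \<open>
  A distribution is given by a frame \<open>\<xi>\<close> of vector fields indexed by the finite type \<open>'r\<close>.
\<close>

definition ham ::
    "('r::finite \<Rightarrow> 'a::real_normed_field ^ 'n::finite \<Rightarrow> 'a ^ 'n) \<Rightarrow> 'a ^ 'r
      \<Rightarrow> 'a ^ 'n \<Rightarrow> 'a ^ 'n \<Rightarrow> 'a"
  where "ham \<xi> u x p = (\<Sum>i\<in>UNIV. u $ i * pairing p (\<xi> i x))"

definition hamilton_at ::
    "('r::finite \<Rightarrow> 'a::real_normed_field ^ 'n::finite \<Rightarrow> 'a ^ 'n) \<Rightarrow> 'a ^ 'r
      \<Rightarrow> ('a \<Rightarrow> 'a ^ 'n) \<Rightarrow> ('a \<Rightarrow> 'a ^ 'n) \<Rightarrow> 'a \<Rightarrow> bool"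
  where "hamilton_at \<xi> u x p t \<longleftrightarrow>
    (\<forall>k. ((\<lambda>s. x s $ k) has_field_derivative
            partial_deriv (\<lambda>p'. ham \<xi> u (x t) p') k (p t)) (at t)) \<and>
    (\<forall>k. ((\<lambda>s. p s $ k) has_field_derivative
            - partial_deriv (\<lambda>x'. ham \<xi> u x' (p t)) k (x t)) (at t))"

definition abnormal_constraint ::
    "('r::finite \<Rightarrow> 'a::real_normed_field ^ 'n::finite \<Rightarrow> 'a ^ 'n)
      \<Rightarrow> 'a ^ 'n \<Rightarrow> 'a ^ 'n \<Rightarrow> bool"
  where "abnormal_constraint \<xi> x p \<longleftrightarrow> (\<forall>i. pairing p (\<xi> i x) = 0) \<and> p \<noteq> 0"

text \<open>
  For \<open>real\<close> the curve is Lipschitz and Hamilton's equations hold almost everywhere; for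
  \<open>complex\<close> it is holomorphic and they hold everywhere.  No regularity is demanded of the
  control \<open>u\<close>: as \<open>\<xi>\<close> is a frame, the equation for the velocity of \<open>x\<close> determines \<open>u\<close>
  (almost everywhere), which is therefore bounded measurable near each point, respectively
  holomorphic.
\<close>

definition abnormal_biextremal_real ::
    "('r::finite \<Rightarrow> real ^ 'n::finite \<Rightarrow> real ^ 'n)
      \<Rightarrow> real set \<Rightarrow> (real \<Rightarrow> real ^ 'n) \<Rightarrow> (real \<Rightarrow> real ^ 'n) \<Rightarrow> bool"
  where "abnormal_biextremal_real \<xi> I x p \<longleftrightarrow>
    open I \<and> connected I \<and>
    (\<exists>L. L-lipschitz_on I x) \<and> (\<exists>L. L-lipschitz_on I p) \<and>
    (\<exists>u. AE t in lebesgue. t \<in> I \<longrightarrow> hamilton_at \<xi> (u t) x p t) \<and>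
    (\<forall>t\<in>I. abnormal_constraint \<xi> (x t) (p t))"

definition abnormal_biextremal_complex ::
    "('r::finite \<Rightarrow> complex ^ 'n::finite \<Rightarrow> complex ^ 'n)
      \<Rightarrow> complex set \<Rightarrow> (complex \<Rightarrow> complex ^ 'n) \<Rightarrow> (complex \<Rightarrow> complex ^ 'n) \<Rightarrow> bool"
  where "abnormal_biextremal_complex \<xi> I x p \<longleftrightarrow>
    open I \<and> connected I \<and>
    (\<forall>k. (\<lambda>t. x t $ k) holomorphic_on I) \<and> (\<forall>k. (\<lambda>t. p t $ k) holomorphic_on I) \<and>
    (\<exists>u. \<forall>t\<in>I. hamilton_at \<xi> (u t) x p t) \<and>
    (\<forall>t\<in>I. abnormal_constraint \<xi> (x t) (p t))"

definition singular_curve_real ::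
    "('r::finite \<Rightarrow> real ^ 'n::finite \<Rightarrow> real ^ 'n)
      \<Rightarrow> real set \<Rightarrow> (real \<Rightarrow> real ^ 'n) \<Rightarrow> bool"
  where "singular_curve_real \<xi> I x \<longleftrightarrow> (\<exists>p. abnormal_biextremal_real \<xi> I x p)"

definition singular_curve_complex ::
    "('r::finite \<Rightarrow> complex ^ 'n::finite \<Rightarrow> complex ^ 'n)
      \<Rightarrow> complex set \<Rightarrow> (complex \<Rightarrow> complex ^ 'n) \<Rightarrow> bool"
  where "singular_curve_complex \<xi> I x \<longleftrightarrow> (\<exists>p. abnormal_biextremal_complex \<xi> I x p)"

text \<open>
  A curve germ at \<open>0\<close> is represented by a curve on a connected open neighbourhood of \<open>0\<close>.
  The derivative at \<open>0\<close> is required to exist, although a Lipschitz curve need not have one.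
\<close>

definition initial_velocities ::
    "('a::real_normed_field set \<Rightarrow> ('a \<Rightarrow> 'a ^ 'n::finite) \<Rightarrow> bool) \<Rightarrow> (('a ^ 'n) \<times> ('a ^ 'n)) set"
  where "initial_velocities C =
    {(x, v). \<exists>I \<gamma>. 0 \<in> I \<and> C I \<gamma> \<and> \<gamma> 0 = x \<and>
       (\<forall>k. ((\<lambda>t. \<gamma> t $ k) has_field_derivative v $ k) (at 0))}"

definition SVC_real ::
    "('r::finite \<Rightarrow> real ^ 'n::finite \<Rightarrow> real ^ 'n) \<Rightarrow> ((real ^ 'n) \<times> (real ^ 'n)) set"
  where "SVC_real \<xi> = initial_velocities (singular_curve_real \<xi>)"

definition SVC_complex ::
    "('r::finite \<Rightarrow> complex ^ 'n::finite \<Rightarrow> complex ^ 'n) \<Rightarrow> ((complex ^ 'n) \<times> (complex ^ 'n)) set"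
  where "SVC_complex \<xi> = initial_velocities (singular_curve_complex \<xi>)"


section \<open>Cartan's model of (8,15)-distribution\<close>

text \<open>
  The indices \<open>1, 2, 3, 4\<close> are the elements of the numeral type \<open>4\<close> (where \<open>4 = 0\<close>, so
  the order of that type is not the one meant by \<open>i < j\<close>).
\<close>

datatype index_pair = P12 | P13 | P14 | P23 | P24 | P34

text \<open>The even permutation \<open>(i,j,h,k)\<close> of \<open>(1,2,3,4)\<close> for each \<open>i < j\<close>.\<close>

primrec even_perm :: "index_pair \<Rightarrow> 4 \<times> 4 \<times> 4 \<times> 4"
  where
    "even_perm P12 = (1, 2, 3, 4)"
  | "even_perm P13 = (1, 3, 4, 2)"
  | "even_perm P14 = (1, 4, 2, 3)"
  | "even_perm P23 = (2, 3, 1, 4)"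
  | "even_perm P24 = (2, 4, 3, 1)"
  | "even_perm P34 = (3, 4, 1, 2)"

datatype coord = Cz | Cx 4 | Cy 4 | Cxx index_pair

lemma UNIV_index_pair: "UNIV = {P12, P13, P14, P23, P24, P34}"
  by (auto intro: index_pair.exhaust)

instance index_pair :: finite
  by standard (simp add: UNIV_index_pair)

lemma UNIV_coord: "UNIV = insert Cz (range Cx \<union> range Cy \<union> range Cxx)"
  by (auto intro: coord.exhaust)

instance coord :: finite
  by standard (simp add: UNIV_coord)

lemma card_coord: "CARD(coord) = 15"
proof -
  have "CARD(index_pair) = 6"
    by (simp add: UNIV_index_pair)
  then have "card (range Cx) = 4" "card (range Cy) = 4" "card (range Cxx) = 6"
    by (simp_all add: card_image inj_on_def)
  moreover have "range Cx \<inter> range Cy = {}" "(range Cx \<union> range Cy) \<inter> range Cxx = {}"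
    by auto
  ultimately show ?thesis
    by (subst UNIV_coord) (auto simp: card_insert_if card_Un_disjoint)
qed

text \<open>The coordinate forms are constant covectors.\<close>

abbreviation dcoord :: "coord \<Rightarrow> 'a::comm_ring_1 ^ coord"
  where "dcoord c \<equiv> axis c 1"

text \<open>The coframe consisting of \<open>\<omega>\<close>, \<open>dx\<^sub>i\<close>, \<open>dy\<^sub>i\<close> and \<open>\<omega>\<^sub>i\<^sub>j\<close>, in the order of the constructors.\<close>

primrec coframe :: "coord \<Rightarrow> 'a::comm_ring_1 ^ coord \<Rightarrow> 'a ^ coord"
  where
    "coframe Cz q = dcoord Cz - (\<Sum>i\<in>UNIV. (q $ Cy i) *s dcoord (Cx i))"
  | "coframe (Cx i) q = dcoord (Cx i)"
  | "coframe (Cy i) q = dcoord (Cy i)"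
  | "coframe (Cxx ij) q = (case even_perm ij of (i, j, h, k) \<Rightarrow>
       dcoord (Cxx ij) -
         ((q $ Cx i) *s dcoord (Cx j) - (q $ Cx j) *s dcoord (Cx i)
          + (q $ Cy h) *s dcoord (Cy k) - (q $ Cy k) *s dcoord (Cy h)))"

definition dual_frame ::
    "('n \<Rightarrow> 'a::comm_ring_1 ^ 'n::finite \<Rightarrow> 'a ^ 'n) \<Rightarrow> 'n \<Rightarrow> 'a ^ 'n \<Rightarrow> 'a ^ 'n"
  where "dual_frame \<theta> b q =
    (THE v. \<forall>a. pairing (\<theta> a q) v = (if a = b then 1 else 0))"

lemma pairing_diff_left: "pairing (p - r) v = pairing p v - pairing r v"
  and pairing_add_left: "pairing (p + r) v = pairing p v + pairing r v"
  and pairing_scale_left: "pairing (c *s p) v = c * pairing p v"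
  by (simp_all add: pairing_def algebra_simps sum_subtractf sum.distrib sum_distrib_left)

lemma pairing_sum_left: "pairing (\<Sum>i\<in>A. f i) v = (\<Sum>i\<in>A. pairing (f i) v)"
proof -
  have "pairing 0 v = 0"
    by (simp add: pairing_def)
  then show ?thesis
    by (induction A rule: infinite_finite_induct) (simp_all add: pairing_add_left)
qed

lemma pairing_axis: "pairing (axis k 1) v = v $ k"
proof -
  have "axis k (1::'a) $ j * v $ j = (if j = k then v $ j else 0)" for j
    by (auto simp: axis_def)
  then show ?thesis
    by (simp add: pairing_def)
qed

lemmas pairing_simps =
  pairing_diff_left pairing_add_left pairing_scale_left pairing_sum_left pairing_axis

lemma ex1_dual_coframe:
  "\<exists>!v. \<forall>a. pairing (coframe a q) v = (if a = b then 1 else 0)"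
proof (rule ex_ex1I)
  define d where "d c = (if c = b then 1 else 0 :: 'a)" for c
  define v :: "'a ^ coord" where "v = (\<chi> c. case c of
      Cz \<Rightarrow> d Cz + (\<Sum>i\<in>UNIV. q $ Cy i * d (Cx i))
    | Cx i \<Rightarrow> d (Cx i)
    | Cy i \<Rightarrow> d (Cy i)
    | Cxx ij \<Rightarrow> (case even_perm ij of (i, j, h, k) \<Rightarrow>
        d (Cxx ij) + (q $ Cx i * d (Cx j) - q $ Cx j * d (Cx i)
          + q $ Cy h * d (Cy k) - q $ Cy k * d (Cy h))))"
  have "pairing (coframe a q) v = d a" for a
    by (cases a) (simp_all add: pairing_simps v_def split: prod.split)
  then show "\<exists>v. \<forall>a. pairing (coframe a q) v = (if a = b then 1 else 0)"
    unfolding d_def by blast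
next
  fix v w
  assume v: "\<forall>a. pairing (coframe a q) v = (if a = b then 1 else 0)"
    and w: "\<forall>a. pairing (coframe a q) w = (if a = b then 1 else 0)"
  have eq: "pairing (coframe a q) v = pairing (coframe a q) w" for a
    using v w by simp
  have x: "v $ Cx i = w $ Cx i" and y: "v $ Cy i = w $ Cy i" for i
    using eq[of "Cx i"] eq[of "Cy i"] by (simp_all add: pairing_simps)
  have "v $ c = w $ c" for c
    using eq[of c] by (cases c) (simp_all add: pairing_simps x y split: prod.splits)
  then show "v = w"
    by (simp add: vec_eq_iff)
qed

lemma pairing_coframe_dual_frame:
  "pairing (coframe a q) (dual_frame coframe b q) = (if a = b then 1 else 0)"
  using theI'[OF ex1_dual_coframe[of q b]] unfolding dual_frame_def by blast

definition X_field :: "4 \<Rightarrow> 'a::comm_ring_1 ^ coord \<Rightarrow> 'a ^ coord"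
  where "X_field i = dual_frame coframe (Cx i)"

definition Y_field :: "4 \<Rightarrow> 'a::comm_ring_1 ^ coord \<Rightarrow> 'a ^ coord"
  where "Y_field j = dual_frame coframe (Cy j)"

text \<open>The frame \<open>X\<^sub>1, \<dots>, X\<^sub>4, Y\<^sub>1, \<dots>, Y\<^sub>4\<close> of the distribution.\<close>

definition cartan_frame :: "4 + 4 \<Rightarrow> 'a::comm_ring_1 ^ coord \<Rightarrow> 'a ^ coord"
  where "cartan_frame = case_sum X_field Y_field"

end

theory Submission
  imports Defs
begin

text \<open>
  Let \<open>\<lambda>\<close> and the entries of a skew matrix \<open>A\<close> be the components of the covector along \<open>z\<close> and the
  \<open>x\<^sub>i\<^sub>j\<close>, and let \<open>B\<close> be the Hodge dual of \<open>A\<close>.  They are constant along an abnormal bi-extremal and do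
  not all vanish.  Differentiating the constraints along a curve with control \<open>(u, v)\<close> gives
  \<open>2Au = \<lambda>v\<close> and \<open>2Bv = -\<lambda>u\<close>.  If \<open>\<lambda> \<noteq> 0\<close>, then \<open>u \<bullet> v = 0\<close> as \<open>A\<close> is skew; if \<open>\<lambda> = 0\<close>, then
  \<open>u \<bullet> v = 0\<close> as every entry of \<open>(u \<bullet> v) A\<close> is a combination of entries of \<open>Au\<close> and \<open>Bv\<close>.  For a
  Lipschitz curve these equations hold only almost everywhere, but the quantities
  \<open>2Ax - \<lambda>y\<close> and \<open>2By + \<lambda>x\<close> are Lipschitz with derivative \<open>0\<close> almost everywhere, so they also
  constrain a derivative of the curve that exists at a prescribed point.

  Conversely, if \<open>u \<bullet> v = 0\<close>, there is \<open>A \<noteq> 0\<close> with \<open>Au = 0\<close> and \<open>Bv = 0\<close>, namely a decomposable one.  The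
  integral curve with constant control \<open>(u, v)\<close> is a straight line, and it is singular with a constant
  covector for which \<open>\<lambda> = 0\<close>.
\<close>

section \<open>Lipschitz functions of one real variable\<close>

lemma lipschitz_increment_le:
  fixes f :: "real \<Rightarrow> real"
  assumes lip: "L-lipschitz_on {a..b} f" and "a \<le> b" and N: "negligible N"
    and deriv: "\<And>t. t \<in> {a<..<b} - N \<Longrightarrow> \<exists>D. (f has_real_derivative D) (at t) \<and> D \<le> B"
  shows "f b - f a \<le> B * (b - a)"
proof (rule ccontr)
  assume "\<not> ?thesis"
  then have less: "B * (b - a) < f b - f a" by simp
  with \<open>a \<le> b\<close> have "a < b" by (cases "a = b") auto
  have "B < (f b - f a) / (b - a)"
    using less \<open>a < b\<close> by (simp add: pos_less_divide_eq)
  \<comment> \<open>\<open>C\<close> leaves room on both sides: off \<open>N\<close> the function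
    \<open>g\<close> has derivative at most \<open>B - C < 0\<close>, and still
    \<open>g a < g b\<close>.\<close>
  then obtain C where C: "B < C" "C < (f b - f a) / (b - a)"
    using dense by blast
  define g where "g t = f t - C * t" for t
  have "C * (b - a) < f b - f a"
    using C(2) \<open>a < b\<close> by (simp add: pos_less_divide_eq)
  then have gab: "g a < g b"
    by (simp add: g_def algebra_simps)
  have cont: "continuous_on {a..b} g"
    unfolding g_def using lipschitz_on_continuous_on[OF lip] by (intro continuous_intros)
  \<comment> \<open>\<open>g\<close> maps \<open>N\<close> to a null set, so it takes an intermediate value only off \<open>N\<close>; at the last
    point with that value \<open>g\<close> would have a negative derivative while staying above the value afterwards.\<close>
  have "negligible (g ` ({a..b} \<inter> N))"
  proof (rule negligible_locally_Lipschitz_image)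
    show "negligible ({a..b} \<inter> N)"
      using N by (simp add: negligible_Int)
    fix x assume x: "x \<in> {a..b} \<inter> N"
    have "norm (g y - g x) \<le> (L + \<bar>C\<bar>) * norm (y - x)" if "y \<in> {a..b} \<inter> N" for y
    proof -
      have "norm (g y - g x) \<le> \<bar>f y - f x\<bar> + \<bar>C * (y - x)\<bar>"
        unfolding g_def real_norm_def by (simp add: algebra_simps)
      moreover have "\<bar>f y - f x\<bar> \<le> L * \<bar>y - x\<bar>"
        using lipschitz_onD[OF lip, of y x] x that by (simp add: dist_real_def)
      ultimately show ?thesis
        by (simp add: abs_mult distrib_right)
    qed
    then show "\<exists>T K. open T \<and> x \<in> T \<and>
        (\<forall>y\<in>({a..b} \<inter> N) \<inter> T. norm (g y - g x) \<le> K * norm (y - x))"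
      by (intro exI[of _ UNIV] exI[of _ "L + \<bar>C\<bar>"]) auto
  qed simp
  moreover have "\<not> negligible {g a<..<g b}"
    using gab open_not_negligible[of "{g a<..<g b}"] by auto
  ultimately have "\<not> {g a<..<g b} \<subseteq> g ` ({a..b} \<inter> N)"
    using negligible_subset by blast
  then obtain y where y: "g a < y" "y < g b" "y \<notin> g ` ({a..b} \<inter> N)"
    by (meson greaterThanLessThan_iff subsetI)
  define S where "S = {t \<in> {a..b}. g t \<le> y}"
  have "closed S"
    unfolding S_def using cont by (intro continuous_on_closed_Collect_le continuous_intros) auto
  then have "compact ({a..b} \<inter> S)"
    by (intro compact_Int_closed) auto
  then have "compact S"
    by (rule back_subst[of compact]) (auto simp: S_def)
  moreover have "a \<in> S"
    using y \<open>a < b\<close> by (simp add: S_def)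
  ultimately obtain c where c: "c \<in> S" "\<And>t. t \<in> S \<Longrightarrow> t \<le> c"
    using compact_attains_sup[of S] by auto
  have "a \<le> c"
    using c(1) by (auto simp: S_def)
  have above: "y < g t" if "c < t" "t \<le> b" for t
    using \<open>a \<le> c\<close> c(2)[of t] that by (force simp: S_def)
  have "c \<in> {a..b}" "g c \<le> y"
    using c(1) by (auto simp: S_def)
  have "c < b"
    using \<open>c \<in> {a..b}\<close> \<open>g c \<le> y\<close> y(2) by (cases "c = b") auto
  have "g c = y"
  proof (rule ccontr)
    assume "g c \<noteq> y"
    with \<open>g c \<le> y\<close> have "g c \<le> y" "y \<le> g b" "c \<le> b"
      using y(2) \<open>c < b\<close> by auto
    then obtain t where "c \<le> t" "t \<le> b" "g t = y"
      using IVT'[of g c y b] continuous_on_subset[OF cont] \<open>c \<in> {a..b}\<close> by auto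
    then show False
      using above[of t] \<open>g c \<noteq> y\<close> by (cases "c = t") auto
  qed
  then have "c \<in> {a<..<b} - N"
    using y \<open>c \<in> {a..b}\<close> \<open>c < b\<close> by (cases "c = a") auto
  then obtain D where D: "(f has_real_derivative D) (at c)" "D \<le> B"
    using deriv by blast
  have "(g has_real_derivative D - C) (at c)"
    unfolding g_def using D(1) by (auto intro!: derivative_eq_intros)
  then obtain d where d: "d > 0" "\<And>h. h > 0 \<Longrightarrow> h < d \<Longrightarrow> g (c + h) < g c"
    using DERIV_neg_dec_right[of g "D - C" c] D(2) C(1) by auto
  define h where "h = min (d / 2) (b - c)"
  have "h > 0" "h < d" "c + h \<le> b"
    using d(1) \<open>c < b\<close> by (auto simp: h_def)
  then show False
    using d(2)[of h] above[of "c + h"] \<open>g c = y\<close> by auto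
qed

lemma lipschitz_increment_abs_le:
  fixes f :: "real \<Rightarrow> real"
  assumes lip: "L-lipschitz_on {a..b} f" and "a \<le> b" and N: "negligible N"
    and deriv: "\<And>t. t \<in> {a<..<b} - N \<Longrightarrow> \<exists>D. (f has_real_derivative D) (at t) \<and> \<bar>D\<bar> \<le> B"
  shows "\<bar>f b - f a\<bar> \<le> B * (b - a)"
proof -
  have "f b - f a \<le> B * (b - a)"
    using deriv by (intro lipschitz_increment_le[OF lip \<open>a \<le> b\<close> N]) (auto simp: abs_le_iff)
  moreover have "- f b - - f a \<le> B * (b - a)"
  proof (rule lipschitz_increment_le[OF _ \<open>a \<le> b\<close> N])
    show "L-lipschitz_on {a..b} (\<lambda>t. - f t)"
      using lip by (rule lipschitz_on_minus)
    fix t assume "t \<in> {a<..<b} - N"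
    then obtain D where "(f has_real_derivative D) (at t)" "\<bar>D\<bar> \<le> B"
      using deriv by blast
    then show "\<exists>D. ((\<lambda>t. - f t) has_real_derivative D) (at t) \<and> D \<le> B"
      by (intro exI[of _ "- D"]) (auto intro!: derivative_eq_intros)
  qed
  ultimately show ?thesis by linarith
qed

text \<open>The increment bound with \<open>B = 0\<close>, applied between any two points of
  \<open>I\<close>. It makes the covector components along \<open>z\<close> and
  \<open>x\<^sub>i\<^sub>j\<close> constant when Hamilton's equations hold only almost
  everywhere.\<close>

lemma lipschitz_AE_deriv_zero_imp_const:
  fixes f :: "real \<Rightarrow> real"
  assumes lip: "L-lipschitz_on I f" and I: "connected I"
    and deriv: "AE t in lebesgue. t \<in> I \<longrightarrow> (f has_real_derivative 0) (at t)"
    and "s \<in> I" "t \<in> I"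
  shows "f s = f t"
proof -
  obtain N where N: "negligible N"
      "{t. \<not> (t \<in> I \<longrightarrow> (f has_real_derivative 0) (at t))} \<subseteq> N"
    using deriv unfolding eventually_ae_filter_negligible by blast
  have *: "f b = f a" if "a \<in> I" "b \<in> I" "a \<le> b" for a b
  proof -
    have sub: "{a..b} \<subseteq> I"
      using I that by (meson connected_contains_Icc)
    have "(f has_real_derivative 0) (at t)" if "t \<in> {a<..<b} - N" for t
    proof -
      from that have "t \<in> {a..b}" "t \<notin> N" by auto
      then show ?thesis using N(2) sub by blast
    qed
    then have "\<bar>f b - f a\<bar> \<le> 0 * (b - a)"
      by (intro lipschitz_increment_abs_le[OF lipschitz_on_subset[OF lip sub] \<open>a \<le> b\<close> N(1)]) auto
    then show ?thesis by simp
  qed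
  show ?thesis
    using *[of s t] *[of t s] assms(4,5) by (cases s t rule: linorder_le_cases) auto
qed

text \<open>A Lipschitz function may be differentiable at a point of the exceptional null set; its
  derivative there is still controlled by the derivatives nearby.\<close>

lemma lipschitz_deriv_zero_if_AE_deriv_small:
  fixes f :: "real \<Rightarrow> real"
  assumes lip: "L-lipschitz_on I f" and I: "open I" "c \<in> I"
    and deriv: "AE t in lebesgue. t \<in> I \<longrightarrow> (\<exists>D. (f has_real_derivative D) (at t) \<and> \<bar>D\<bar> \<le> e t)"
    and e: "(e \<longlongrightarrow> 0) (at c)"
    and D: "(f has_real_derivative D) (at c)"
  shows "D = 0"
proof -
  obtain N where N: "negligible N"
      "{t. \<not> (t \<in> I \<longrightarrow> (\<exists>D. (f has_real_derivative D) (at t) \<and> \<bar>D\<bar> \<le> e t))} \<subseteq> N"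
    using deriv by (auto simp: eventually_ae_filter_negligible)
  have "\<bar>D\<bar> \<le> \<epsilon>" if "\<epsilon> > 0" for \<epsilon>
  proof -
    obtain r where r: "r > 0" "cball c r \<subseteq> I"
      using I open_contains_cball by blast
    have "\<forall>\<^sub>F t in at c. \<bar>e t\<bar> < \<epsilon>"
      using tendstoD[OF e \<open>\<epsilon> > 0\<close>] by (simp add: dist_real_def)
    then obtain d where d: "d > 0" "\<And>t. t \<noteq> c \<Longrightarrow> dist t c < d \<Longrightarrow> \<bar>e t\<bar> < \<epsilon>"
      by (auto simp: eventually_at)
    \<comment> \<open>Bounding the right-hand difference quotients is enough, because
      \<open>D\<close> is their limit too.\<close>
    have "\<bar>f t - f c\<bar> \<le> \<epsilon> * (t - c)" if t: "c < t" "t < c + min d r" for t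
    proof (rule lipschitz_increment_abs_le[OF _ _ N(1)])
      have sub: "{c..t} \<subseteq> I"
        using t r by (force simp: dist_real_def)
      show "L-lipschitz_on {c..t} f"
        by (rule lipschitz_on_subset[OF lip sub])
      fix s assume s: "s \<in> {c<..<t} - N"
      then have "s \<in> I" using sub by auto
      then obtain D where D: "(f has_real_derivative D) (at s)" "\<bar>D\<bar> \<le> e s"
        using N(2) s by blast
      moreover have "\<bar>e s\<bar> < \<epsilon>"
        using s t by (intro d(2)) (auto simp: dist_real_def)
      ultimately show "\<exists>D. (f has_real_derivative D) (at s) \<and> \<bar>D\<bar> \<le> \<epsilon>"
        by (intro exI[of _ D]) auto
    qed (use t in auto)
    then have "\<forall>\<^sub>F t in at_right c. \<bar>(f t - f c) / (t - c)\<bar> \<le> \<epsilon>"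
      using d(1) r(1) by (intro eventually_at_rightI[of c "c + min d r"])
        (auto simp: abs_divide pos_divide_le_eq)
    moreover have "((\<lambda>t. \<bar>(f t - f c) / (t - c)\<bar>) \<longlongrightarrow> \<bar>D\<bar>) (at_right c)"
      using D by (intro tendsto_rabs) (auto simp: has_field_derivative_iff
          intro: filterlim_mono[OF _ order_refl at_le])
    ultimately show ?thesis
      by (intro tendsto_upperbound) auto
  qed
  then show ?thesis
    using field_le_epsilon[of "\<bar>D\<bar>" 0] by auto
qed

lemma lipschitz_on_linear:
  fixes f :: "'a::euclidean_space \<Rightarrow> 'b::real_normed_vector"
  assumes "L-lipschitz_on I x" "linear f"
  shows "\<exists>K. K-lipschitz_on I (\<lambda>t. f (x t))"
proof -
  have "bounded_linear f"
    using assms(2) by (simp add: linear_conv_bounded_linear)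
  then obtain B where "B-lipschitz_on (x ` I) f"
    using bounded_linear.lipschitz_boundE by blast
  then show ?thesis
    using lipschitz_on_compose2[OF assms(1)] by blast
qed

text \<open>Difference quotients are bounded by \<open>L\<close>, hence so is their limit. Applied
  to the coordinates \<open>x\<^sub>i\<close> and \<open>y\<^sub>i\<close> of a curve, this bounds
  its control, about which nothing is assumed.\<close>

lemma lipschitz_on_DERIV_bound:
  fixes f :: "real \<Rightarrow> real"
  assumes lip: "L-lipschitz_on I f" and "open I" "t \<in> I"
    and D: "(f has_real_derivative D) (at t)"
  shows "\<bar>D\<bar> \<le> L"
proof (rule tendsto_upperbound)
  show "((\<lambda>s. \<bar>(f s - f t) / (s - t)\<bar>) \<longlongrightarrow> \<bar>D\<bar>) (at t)"
    using D by (intro tendsto_rabs) (simp add: has_field_derivative_iff)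
  have "\<forall>\<^sub>F s in at t. s \<in> I"
    using assms(2,3) by (rule eventually_at_in_open')
  moreover have "\<forall>\<^sub>F s in at t. s \<noteq> t"
    by (simp add: eventually_at_filter)
  ultimately show "\<forall>\<^sub>F s in at t. \<bar>(f s - f t) / (s - t)\<bar> \<le> L"
  proof eventually_elim
    case (elim s)
    then show ?case
      using lipschitz_onD[OF lip, of s t] \<open>t \<in> I\<close>
      by (simp add: abs_divide dist_real_def pos_divide_le_eq)
  qed
qed simp

section \<open>Skew matrices in dimension four and Hodge duality\<close>

text \<open>
  The numbers \<open>m c\<close> are the entries above the diagonal of a skew matrix \<open>A\<close>.  Then \<open>rotX m\<close> is
  multiplication by \<open>A\<close>, and \<open>rotY m\<close> is multiplication by its Hodge dual, the skew matrix \<open>B\<close> with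
  \<open>B\<^sub>h\<^sub>k = A\<^sub>i\<^sub>j\<close> for even permutations \<open>(i, j, h, k)\<close>.
\<close>

definition rotX :: "(index_pair \<Rightarrow> 'a::comm_ring_1) \<Rightarrow> (4 \<Rightarrow> 'a) \<Rightarrow> 4 \<Rightarrow> 'a"
  where "rotX m w i = (\<Sum>c\<in>UNIV. m c * (case even_perm c of (a, b, h, k) \<Rightarrow>
    (if i = a then w b else 0) - (if i = b then w a else 0)))"

definition rotY :: "(index_pair \<Rightarrow> 'a::comm_ring_1) \<Rightarrow> (4 \<Rightarrow> 'a) \<Rightarrow> 4 \<Rightarrow> 'a"
  where "rotY m w i = (\<Sum>c\<in>UNIV. m c * (case even_perm c of (a, b, h, k) \<Rightarrow>
    (if i = h then w k else 0) - (if i = k then w h else 0)))"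

lemma sum_index_pair:
  "(\<Sum>c\<in>UNIV. f c) = f P12 + f P13 + f P14 + f P23 + f P24 + f P34"
  by (simp add: UNIV_index_pair add.assoc)

lemma rotX_linear: "rotX m (\<lambda>j. u j + v j) i = rotX m u i + rotX m v i"
    "rotX m (\<lambda>j. c * u j) i = c * rotX m u i"
  unfolding rotX_def sum_distrib_left sum.distrib[symmetric]
  by (auto intro!: sum.cong split: prod.splits simp: algebra_simps)

lemma rotY_linear: "rotY m (\<lambda>j. u j + v j) i = rotY m u i + rotY m v i"
    "rotY m (\<lambda>j. c * u j) i = c * rotY m u i"
  unfolding rotY_def sum_distrib_left sum.distrib[symmetric]
  by (auto intro!: sum.cong split: prod.splits simp: algebra_simps)

lemma sum_mult_rotX: "(\<Sum>i\<in>UNIV. u i * rotX m w i) = - (\<Sum>i\<in>UNIV. w i * rotX m u i)"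
  by (simp add: rotX_def sum_4 sum_index_pair algebra_simps)

lemma sum_mult_rotY: "(\<Sum>i\<in>UNIV. u i * rotY m w i) = - (\<Sum>i\<in>UNIV. w i * rotY m u i)"
  by (simp add: rotY_def sum_4 sum_index_pair algebra_simps)

text \<open>The entries \<open>A\<^sub>i\<^sub>j\<close> and \<open>B\<^sub>h\<^sub>k\<close> are
  both \<open>m c\<close>, and their terms give the four summands of \<open>u \<bullet> v\<close>.
  The remaining terms cancel because duality matches the other entries of \<open>A\<close> and
  \<open>B\<close> in pairs.\<close>

lemma mult_pairing_eq_rot:
  "m c * (\<Sum>i\<in>UNIV. u i * v i) = (case even_perm c of (i, j, h, k) \<Rightarrow>
     v j * rotX m u i - v i * rotX m u j + u k * rotY m v h - u h * rotY m v k)"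
  by (cases c) (simp_all add: rotX_def rotY_def sum_4 sum_index_pair algebra_simps)

lemma rot_eqs_imp_null:
  fixes u v :: "4 \<Rightarrow> 'a::{idom,ring_char_0}"
  assumes X: "\<And>i. 2 * rotX m u i = l * v i" and Y: "\<And>i. 2 * rotY m v i = - (l * u i)"
    and "l \<noteq> 0 \<or> (\<exists>c. m c \<noteq> 0)"
  shows "(\<Sum>i\<in>UNIV. u i * v i) = 0"
proof (cases "l = 0")
  case True
  then obtain c where "m c \<noteq> 0"
    using assms(3) by auto
  moreover have "rotX m u i = 0" "rotY m v i = 0" for i
    using X[of i] Y[of i] True by simp_all
  then have "m c * (\<Sum>i\<in>UNIV. u i * v i) = 0"
    by (simp add: mult_pairing_eq_rot split: prod.split)
  ultimately show ?thesis by simp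
next
  case False
  have "l * (\<Sum>i\<in>UNIV. u i * v i) = 2 * (\<Sum>i\<in>UNIV. u i * rotX m u i)"
    unfolding sum_distrib_left by (intro sum.cong refl) (simp add: X algebra_simps)
  also have "\<dots> = 0"
    using sum_mult_rotX[of u m u] by (simp add: eq_neg_iff_add_eq_0)
  finally show ?thesis
    using False by simp
qed

text \<open>Supplies the second factor of a decomposable skew matrix. Two indices besides
  \<open>a\<close> leave a plane of vectors with \<open>w a = 0\<close>, which contains a nonzero
  \<open>w\<close> orthogonal to \<open>v\<close>; since \<open>u a \<noteq> 0\<close>, some minor
  of \<open>u\<close> and \<open>w\<close> is nonzero.\<close>

lemma ex_orthogonal_independent:
  fixes u v :: "4 \<Rightarrow> 'a::field"
  assumes "u a \<noteq> 0"
  obtains w h k where "(\<Sum>i\<in>UNIV. w i * v i) = 0" "u h * w k \<noteq> u k * w h"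
proof -
  have "\<exists>b c. b \<noteq> a \<and> c \<noteq> a \<and> b \<noteq> (c::4)"
    by (intro exI[of _ "a + 1"] exI[of _ "a + 2"]) simp
  then obtain b c where bc: "b \<noteq> a" "c \<noteq> a" "b \<noteq> (c::4)" by auto
  \<comment> \<open>A nonzero solution of \<open>\<beta> * v b + \<gamma> * v c = 0\<close>; the
    formula \<open>(v c, - v b)\<close> could give zero when \<open>v b = 0\<close>, and then
    \<open>(1, 0)\<close> replaces it.\<close>
  define \<beta> \<gamma> where "\<beta> = (if v b = 0 then 1 else v c)" and "\<gamma> = (if v b = 0 then 0 else - v b)"
  define w where "w x = (if x = b then \<beta> else 0) + (if x = c then \<gamma> else 0)" for x
  have "(\<Sum>i\<in>UNIV. w i * v i) = \<beta> * v b + \<gamma> * v c"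
    by (simp add: w_def distrib_right sum.distrib if_distrib[of "\<lambda>x. x * _"] cong: if_cong)
  then have "(\<Sum>i\<in>UNIV. w i * v i) = 0"
    by (simp add: \<beta>_def \<gamma>_def)
  moreover have "w a = 0" "w b \<noteq> 0 \<or> w c \<noteq> 0"
    using bc by (auto simp: w_def \<beta>_def \<gamma>_def)
  then have "u a * w b \<noteq> u b * w a \<or> u a * w c \<noteq> u c * w a"
    using assms by auto
  ultimately show thesis
    using that by blast
qed

text \<open>Up to order, both the first two and the last two entries of \<open>even_perm\<close> run
  through all pairs of distinct indices. A nonzero minor at \<open>h\<close>, \<open>k\<close> is
  therefore a nonzero \<open>m c\<close> up to sign.\<close>

lemma even_perm_cases:
  fixes h k :: 4
  assumes "h \<noteq> k"
  shows "\<exists>c i j. even_perm c = (i, j, h, k) \<or> even_perm c = (i, j, k, h)"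
    and "\<exists>c i j. even_perm c = (h, k, i, j) \<or> even_perm c = (k, h, i, j)"
proof -
  have ex: "(\<exists>c. P c) \<longleftrightarrow> P P12 \<or> P P13 \<or> P P14 \<or> P P23 \<or> P P24 \<or> P P34" for P
    by (metis index_pair.exhaust)
  show "\<exists>c i j. even_perm c = (i, j, h, k) \<or> even_perm c = (i, j, k, h)"
    and "\<exists>c i j. even_perm c = (h, k, i, j) \<or> even_perm c = (k, h, i, j)"
    using exhaust_4[of h] exhaust_4[of k] assms unfolding ex by auto
qed

text \<open>If \<open>B = u \<and> w\<close> with \<open>w\<close> orthogonal to \<open>v\<close>,
  then \<open>Bv = (w \<bullet> v) u - (u \<bullet> v) w = 0\<close>, while the dual
  \<open>A\<close> kills \<open>u\<close> because \<open>u \<and> w \<and> u = 0\<close>. If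
  \<open>v\<close> is the nonzero vector, the roles of \<open>A\<close> and \<open>B\<close> are
  exchanged.\<close>

lemma ex_rot_kernel:
  fixes u v :: "4 \<Rightarrow> 'a::field"
  assumes uv: "(\<Sum>i\<in>UNIV. u i * v i) = 0"
  obtains m c where "m c \<noteq> 0" "\<And>i. rotX m u i = 0" "\<And>i. rotY m v i = 0"
proof (cases "u = (\<lambda>_. 0) \<and> v = (\<lambda>_. 0)")
  case True
  then show thesis
    by (intro that[of "\<lambda>_. 1" P12]) (simp_all add: rotX_def rotY_def split: prod.splits)
next
  case False
  then consider a where "u a \<noteq> 0" | a where "v a \<noteq> 0" by (auto simp: fun_eq_iff)
  then show thesis
  proof cases
    case 1
    then obtain w h k where w: "(\<Sum>i\<in>UNIV. w i * v i) = 0" and hk: "u h * w k \<noteq> u k * w h"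
      by (rule ex_orthogonal_independent)
    \<comment> \<open>\<open>B = u \<and> w\<close>\<close>
    define m where "m c = (case even_perm c of (i, j, h, k) \<Rightarrow> u h * w k - u k * w h)" for c
    have "h \<noteq> k" using hk by auto
    then obtain c i j where "even_perm c = (i, j, h, k) \<or> even_perm c = (i, j, k, h)"
      using even_perm_cases(1) by blast
    then have "m c \<noteq> 0"
      using hk by (auto simp: m_def)
    moreover have "rotX m u i = 0" for i
      using exhaust_4[of i]
      by (elim disjE) (simp_all add: rotX_def m_def sum_index_pair algebra_simps)
    moreover have "rotY m v i = u i * (\<Sum>j\<in>UNIV. w j * v j) - w i * (\<Sum>j\<in>UNIV. u j * v j)" for i
      using exhaust_4[of i]
      by (elim disjE) (simp_all add: rotY_def m_def sum_index_pair sum_4 algebra_simps)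
    then have "rotY m v i = 0" for i by (simp add: w uv)
    ultimately show thesis by (rule that)
  next
    case 2
    then obtain w h k where w: "(\<Sum>i\<in>UNIV. w i * u i) = 0" and hk: "v h * w k \<noteq> v k * w h"
      by (rule ex_orthogonal_independent)
    \<comment> \<open>\<open>A = v \<and> w\<close>\<close>
    define m where "m c = (case even_perm c of (i, j, h, k) \<Rightarrow> v i * w j - v j * w i)" for c
    have "h \<noteq> k" using hk by auto
    then obtain c i j where "even_perm c = (h, k, i, j) \<or> even_perm c = (k, h, i, j)"
      using even_perm_cases(2) by blast
    then have "m c \<noteq> 0"
      using hk by (auto simp: m_def)
    moreover have "rotX m u i = v i * (\<Sum>j\<in>UNIV. w j * u j) - w i * (\<Sum>j\<in>UNIV. u j * v j)" for i
      using exhaust_4[of i]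
      by (elim disjE) (simp_all add: rotX_def m_def sum_index_pair sum_4 algebra_simps)
    then have "rotX m u i = 0" for i by (simp add: w uv)
    moreover have "rotY m v i = 0" for i
      using exhaust_4[of i]
      by (elim disjE) (simp_all add: rotY_def m_def sum_index_pair algebra_simps)
    ultimately show thesis by (blast intro: that)
  qed
qed

section \<open>Bi-extremals of the Cartan frame\<close>

lemma sum_coord:
  "(\<Sum>c\<in>UNIV. f c) = f Cz + (\<Sum>i\<in>UNIV. f (Cx i)) + (\<Sum>i\<in>UNIV. f (Cy i)) + (\<Sum>c\<in>UNIV. f (Cxx c))"
proof -
  have "sum f (range Cx \<union> range Cy \<union> range Cxx) =
      sum f (range Cx) + sum f (range Cy) + sum f (range Cxx)"
    by (subst sum.union_disjoint, simp, simp, blast)+ (rule refl)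
  then show ?thesis
    by (subst UNIV_coord, subst sum.insert)
      (auto simp: sum.reindex inj_on_def add.assoc)
qed

lemma sum_Plus_UNIV:
  "(\<Sum>i\<in>UNIV. f i) = (\<Sum>i\<in>UNIV. f (Inl i)) + (\<Sum>i\<in>UNIV. f (Inr i))"
  for f :: "'a::finite + 'b::finite \<Rightarrow> 'c::comm_monoid_add"
  by (simp add: UNIV_Plus_UNIV[symmetric] sum.Plus del: UNIV_Plus_UNIV)

text \<open>The components are solved for from the duality relations, first those along
  \<open>x\<^sub>j\<close> and \<open>y\<^sub>j\<close>, then those along \<open>z\<close> and
  \<open>x\<^sub>i\<^sub>j\<close>, whose forms involve the former.\<close>

lemma X_field_nth:
  "X_field i q $ Cz = q $ Cy i"
  "X_field i q $ Cx j = (if j = i then 1 else 0)"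
  "X_field i q $ Cy j = 0"
  "X_field i q $ Cxx c = (case even_perm c of (a, b, h, k) \<Rightarrow>
     q $ Cx a * (if b = i then 1 else 0) - q $ Cx b * (if a = i then 1 else 0))"
proof -
  have eq: "pairing (coframe c q) (X_field i q) = (if c = Cx i then 1 else 0)" for c
    unfolding X_field_def by (rule pairing_coframe_dual_frame)
  show x: "X_field i q $ Cx j = (if j = i then 1 else 0)" for j
    using eq[of "Cx j"] by (simp add: pairing_simps)
  show y: "X_field i q $ Cy j = 0" for j
    using eq[of "Cy j"] by (simp add: pairing_simps)
  show "X_field i q $ Cz = q $ Cy i"
    using eq[of Cz] by (simp add: pairing_simps x mult_delta_right)
  show "X_field i q $ Cxx c = (case even_perm c of (a, b, h, k) \<Rightarrow>
     q $ Cx a * (if b = i then 1 else 0) - q $ Cx b * (if a = i then 1 else 0))"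
    using eq[of "Cxx c"] by (simp add: pairing_simps x y split: prod.splits)
qed

lemma Y_field_nth:
  "Y_field i q $ Cz = 0"
  "Y_field i q $ Cx j = 0"
  "Y_field i q $ Cy j = (if j = i then 1 else 0)"
  "Y_field i q $ Cxx c = (case even_perm c of (a, b, h, k) \<Rightarrow>
     q $ Cy h * (if k = i then 1 else 0) - q $ Cy k * (if h = i then 1 else 0))"
proof -
  have eq: "pairing (coframe c q) (Y_field i q) = (if c = Cy i then 1 else 0)" for c
    unfolding Y_field_def by (rule pairing_coframe_dual_frame)
  show x: "Y_field i q $ Cx j = 0" for j
    using eq[of "Cx j"] by (simp add: pairing_simps)
  show y: "Y_field i q $ Cy j = (if j = i then 1 else 0)" for j
    using eq[of "Cy j"] by (simp add: pairing_simps)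
  show "Y_field i q $ Cz = 0"
    using eq[of Cz] by (simp add: pairing_simps x)
  show "Y_field i q $ Cxx c = (case even_perm c of (a, b, h, k) \<Rightarrow>
     q $ Cy h * (if k = i then 1 else 0) - q $ Cy k * (if h = i then 1 else 0))"
    using eq[of "Cxx c"] by (simp add: pairing_simps x y split: prod.splits)
qed

lemma pairing_X_field:
  "pairing p (X_field i q) =
    p $ Cx i + p $ Cz * q $ Cy i - rotX (\<lambda>c. p $ Cxx c) (\<lambda>j. q $ Cx j) i"
proof -
  have "(\<Sum>c\<in>UNIV. p $ Cxx c * X_field i q $ Cxx c) = - rotX (\<lambda>c. p $ Cxx c) (\<lambda>j. q $ Cx j) i"
    unfolding rotX_def sum_negf[symmetric] X_field_nth
    by (intro sum.cong) (auto split: prod.splits)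
  then show ?thesis
    by (simp add: pairing_def sum_coord X_field_nth(1-3) mult_delta_right)
qed

lemma pairing_Y_field:
  "pairing p (Y_field i q) = p $ Cy i - rotY (\<lambda>c. p $ Cxx c) (\<lambda>j. q $ Cy j) i"
proof -
  have "(\<Sum>c\<in>UNIV. p $ Cxx c * Y_field i q $ Cxx c) = - rotY (\<lambda>c. p $ Cxx c) (\<lambda>j. q $ Cy j) i"
    unfolding rotY_def sum_negf[symmetric] Y_field_nth
    by (intro sum.cong) (auto split: prod.splits)
  then show ?thesis
    by (simp add: pairing_def sum_coord Y_field_nth(1-3) mult_delta_right)
qed

text \<open>An exact expansion is available because the Hamiltonian is linear in the covector and,
  for the Cartan frame, affine in each coordinate of the point.\<close>

lemma partial_deriv_eqI:
  assumes "\<And>s. f (q + s *s axis k 1) = f q + s * D"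
  shows "partial_deriv f k q = D"
  unfolding partial_deriv_def assms by (rule DERIV_imp_deriv) (auto intro!: derivative_eq_intros)

lemma partial_deriv_ham_covector:
  "partial_deriv (\<lambda>p. ham \<xi> u x p) k p = (\<Sum>i\<in>UNIV. u $ i * \<xi> i x $ k)"
proof (rule partial_deriv_eqI)
  fix s
  show "ham \<xi> u x (p + s *s axis k 1) = ham \<xi> u x p + s * (\<Sum>i\<in>UNIV. u $ i * \<xi> i x $ k)"
    by (simp add: ham_def pairing_simps distrib_left sum.distrib sum_distrib_left mult_ac)
qed

text \<open>The entries of \<open>A\<close>. They are conserved because the frame does not involve
  the coordinates \<open>x\<^sub>i\<^sub>j\<close>.\<close>

abbreviation central :: "'a ^ coord \<Rightarrow> index_pair \<Rightarrow> 'a"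
  where "central p c \<equiv> p $ Cxx c"

text \<open>Skewness moves \<open>A\<close> and \<open>B\<close> from the point to the control, so
  that the coefficients of \<open>x\<^sub>i\<close> and \<open>y\<^sub>i\<close> become
  visible.\<close>

lemma ham_cartan_frame:
  "ham cartan_frame u x p =
    (\<Sum>i\<in>UNIV. u $ Inl i * p $ Cx i) + (\<Sum>i\<in>UNIV. u $ Inr i * p $ Cy i) +
    (\<Sum>i\<in>UNIV. x $ Cx i * rotX (central p) (\<lambda>i. u $ Inl i) i) +
    (\<Sum>i\<in>UNIV. x $ Cy i * (p $ Cz * u $ Inl i + rotY (central p) (\<lambda>i. u $ Inr i) i))"
proof -
  have "ham cartan_frame u x p =
    (\<Sum>i\<in>UNIV. u $ Inl i * p $ Cx i) + (\<Sum>i\<in>UNIV. u $ Inr i * p $ Cy i) +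
    (\<Sum>i\<in>UNIV. x $ Cy i * (p $ Cz * u $ Inl i)) -
    (\<Sum>i\<in>UNIV. u $ Inl i * rotX (central p) (\<lambda>i. x $ Cx i) i) -
    (\<Sum>i\<in>UNIV. u $ Inr i * rotY (central p) (\<lambda>i. x $ Cy i) i)"
    by (simp add: ham_def sum_Plus_UNIV cartan_frame_def pairing_X_field pairing_Y_field
        algebra_simps sum.distrib sum_subtractf)
  then show ?thesis
    unfolding sum_mult_rotX[of "\<lambda>i. u $ Inl i"] sum_mult_rotY[of "\<lambda>i. u $ Inr i"]
    by (simp add: distrib_left sum.distrib)
qed

lemma partial_deriv_ham_cartan_point:
  "partial_deriv (\<lambda>x. ham cartan_frame u x p) k x = (case k of
      Cz \<Rightarrow> 0
    | Cx i \<Rightarrow> rotX (central p) (\<lambda>i. u $ Inl i) i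
    | Cy i \<Rightarrow> p $ Cz * u $ Inl i + rotY (central p) (\<lambda>i. u $ Inr i) i
    | Cxx c \<Rightarrow> 0)" (is "_ = ?D k")
proof (rule partial_deriv_eqI)
  fix s
  show "ham cartan_frame u (x + s *s axis k 1) p = ham cartan_frame u x p + s * ?D k"
    by (cases k)
      (simp_all add: ham_cartan_frame axis_def distrib_right sum.distrib mult_delta_left mult_delta_right
        if_distrib[of "\<lambda>x. x * _"] cong: if_cong)
qed

lemma hamilton_at_cartan_iff:
  "hamilton_at cartan_frame u x p t \<longleftrightarrow>
    (\<forall>k. ((\<lambda>s. x s $ k) has_field_derivative
      (\<Sum>i\<in>UNIV. u $ i * cartan_frame i (x t) $ k)) (at t)) \<and>
    ((\<lambda>s. p s $ Cz) has_field_derivative 0) (at t) \<and>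
    (\<forall>i. ((\<lambda>s. p s $ Cx i) has_field_derivative
      - rotX (central (p t)) (\<lambda>i. u $ Inl i) i) (at t)) \<and>
    (\<forall>i. ((\<lambda>s. p s $ Cy i) has_field_derivative
      - (p t $ Cz * u $ Inl i + rotY (central (p t)) (\<lambda>i. u $ Inr i) i)) (at t)) \<and>
    (\<forall>c. ((\<lambda>s. p s $ Cxx c) has_field_derivative 0) (at t))"
proof -
  have all: "(\<forall>k. P k) \<longleftrightarrow> P Cz \<and> (\<forall>i. P (Cx i)) \<and> (\<forall>i. P (Cy i)) \<and> (\<forall>c. P (Cxx c))" for P
    by (metis coord.exhaust)
  show ?thesis
    unfolding hamilton_at_def partial_deriv_ham_covector partial_deriv_ham_cartan_point
    by (subst (2) all) simp
qed

text \<open>The eight constraints express the components of \<open>p\<close> along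
  \<open>x\<^sub>i\<close> and \<open>y\<^sub>i\<close> by the others, so \<open>p\<close> vanishes
  only if \<open>\<lambda>\<close> and \<open>A\<close> do.\<close>

lemma abnormal_constraint_cartan_iff:
  "abnormal_constraint cartan_frame x p \<longleftrightarrow>
    (\<forall>i. p $ Cx i = rotX (central p) (\<lambda>i. x $ Cx i) i - p $ Cz * x $ Cy i) \<and>
    (\<forall>i. p $ Cy i = rotY (central p) (\<lambda>i. x $ Cy i) i) \<and>
    (p $ Cz \<noteq> 0 \<or> (\<exists>c. p $ Cxx c \<noteq> 0))" (is "_ \<longleftrightarrow> ?X \<and> ?Y \<and> ?N")
proof -
  have "(\<forall>i. pairing p (cartan_frame i x) = 0) \<longleftrightarrow> ?X \<and> ?Y"
    by (auto simp: cartan_frame_def pairing_X_field pairing_Y_field algebra_simps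
        eq_neg_iff_add_eq_0 split_sum_all)
  moreover have "p \<noteq> 0 \<longleftrightarrow> ?N" if ?X ?Y
  proof
    assume "p \<noteq> 0"
    then obtain k where "p $ k \<noteq> 0" by (auto simp: vec_eq_iff)
    moreover have "p $ k = 0" if "p $ Cz = 0" "\<And>c. p $ Cxx c = 0"
      using that \<open>?X\<close> \<open>?Y\<close> by (cases k) (simp_all add: rotX_def rotY_def)
    ultimately show ?N by blast
  qed auto
  ultimately show ?thesis
    unfolding abnormal_constraint_def by blast
qed

text \<open>The matrix may vary with \<open>t\<close>: at a single point only the vanishing of its
  derivative is known, and the product rule then leaves the term with \<open>w'\<close>.\<close>

lemma DERIV_rotX:
  assumes "\<And>c. ((\<lambda>t. m t c) has_field_derivative 0) (at t)"
    and "\<And>j. ((\<lambda>t. w t j) has_field_derivative w' j) (at t)"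
  shows "((\<lambda>t. rotX (m t) (w t) i) has_field_derivative rotX (m t) w' i) (at t)"
  unfolding rotX_def
proof (rule DERIV_sum)
  fix c
  have "((\<lambda>t. case even_perm c of (a, b, h, k) \<Rightarrow>
        (if i = a then w t b else 0) - (if i = b then w t a else 0)) has_field_derivative
      (case even_perm c of (a, b, h, k) \<Rightarrow>
        (if i = a then w' b else 0) - (if i = b then w' a else 0))) (at t)"
    by (cases "even_perm c") (auto intro!: DERIV_diff DERIV_minus assms(2))
  from DERIV_mult[OF assms(1)[of c] this]
  show "((\<lambda>t. m t c * (case even_perm c of (a, b, h, k) \<Rightarrow>
        (if i = a then w t b else 0) - (if i = b then w t a else 0))) has_field_derivative
      m t c * (case even_perm c of (a, b, h, k) \<Rightarrow>
        (if i = a then w' b else 0) - (if i = b then w' a else 0))) (at t)"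
    by (simp add: mult.commute)
qed

lemma DERIV_rotY:
  assumes "\<And>c. ((\<lambda>t. m t c) has_field_derivative 0) (at t)"
    and "\<And>j. ((\<lambda>t. w t j) has_field_derivative w' j) (at t)"
  shows "((\<lambda>t. rotY (m t) (w t) i) has_field_derivative rotY (m t) w' i) (at t)"
  unfolding rotY_def
proof (rule DERIV_sum)
  fix c
  have "((\<lambda>t. case even_perm c of (a, b, h, k) \<Rightarrow>
        (if i = h then w t k else 0) - (if i = k then w t h else 0)) has_field_derivative
      (case even_perm c of (a, b, h, k) \<Rightarrow>
        (if i = h then w' k else 0) - (if i = k then w' h else 0))) (at t)"
    by (cases "even_perm c") (auto intro!: DERIV_diff DERIV_minus assms(2))
  from DERIV_mult[OF assms(1)[of c] this]
  show "((\<lambda>t. m t c * (case even_perm c of (a, b, h, k) \<Rightarrow>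
        (if i = h then w t k else 0) - (if i = k then w t h else 0))) has_field_derivative
      m t c * (case even_perm c of (a, b, h, k) \<Rightarrow>
        (if i = h then w' k else 0) - (if i = k then w' h else 0))) (at t)"
    by (simp add: mult.commute)
qed

lemma sum_cartan_frame_nth:
  "(\<Sum>i\<in>UNIV. u $ i * cartan_frame i q $ Cx j) = u $ Inl j"
  "(\<Sum>i\<in>UNIV. u $ i * cartan_frame i q $ Cy j) = u $ Inr j"
  by (simp_all add: sum_Plus_UNIV cartan_frame_def X_field_nth Y_field_nth mult_delta_right)

text \<open>The constraints hold near \<open>t\<close>, so they can be differentiated at
  \<open>t\<close>. This gives a second expression for the derivatives of \<open>p\<close> along
  \<open>x\<^sub>i\<close> and \<open>y\<^sub>i\<close>; comparing it with Hamilton's equations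
  doubles \<open>Au\<close> and \<open>Bv\<close>.\<close>

lemma bicharacteristic_velocity_eqs:
  assumes ham: "hamilton_at cartan_frame u x p t"
    and I: "open I" "t \<in> I" "\<And>s. s \<in> I \<Longrightarrow> abnormal_constraint cartan_frame (x s) (p s)"
  shows "2 * rotX (central (p t)) (\<lambda>i. u $ Inl i) i = p t $ Cz * u $ Inr i"
    and "2 * rotY (central (p t)) (\<lambda>i. u $ Inr i) i = - (p t $ Cz * u $ Inl i)"
proof -
  note H = ham[unfolded hamilton_at_cartan_iff]
  have x: "((\<lambda>s. x s $ Cx j) has_field_derivative u $ Inl j) (at t)"
    and y: "((\<lambda>s. x s $ Cy j) has_field_derivative u $ Inr j) (at t)" for j
    using conjunct1[OF H, rule_format, of "Cx j"] conjunct1[OF H, rule_format, of "Cy j"]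
    unfolding sum_cartan_frame_nth by simp_all
  have ev: "\<forall>\<^sub>F s in nhds t. s \<in> I"
    using I by (simp add: eventually_nhds_in_open)
  have z: "((\<lambda>s. p s $ Cz) has_field_derivative 0) (at t)"
    and m: "\<And>c. ((\<lambda>s. p s $ Cxx c) has_field_derivative 0) (at t)"
    and px: "((\<lambda>s. p s $ Cx i) has_field_derivative - rotX (central (p t)) (\<lambda>i. u $ Inl i) i) (at t)"
    and py: "((\<lambda>s. p s $ Cy i) has_field_derivative
      - (p t $ Cz * u $ Inl i + rotY (central (p t)) (\<lambda>i. u $ Inr i) i)) (at t)"
    using H by blast+
  have "\<forall>\<^sub>F s in nhds t.
      p s $ Cx i = rotX (central (p s)) (\<lambda>j. x s $ Cx j) i - p s $ Cz * x s $ Cy i"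
    using ev by eventually_elim (use I(3) in \<open>auto simp: abnormal_constraint_cartan_iff\<close>)
  from DERIV_cong_ev[OF refl this refl, THEN iffD1, OF px]
    DERIV_diff[OF DERIV_rotX[OF m x] DERIV_mult[OF z y]]
  have "- rotX (central (p t)) (\<lambda>i. u $ Inl i) i =
      rotX (central (p t)) (\<lambda>i. u $ Inl i) i - (0 * x t $ Cy i + u $ Inr i * p t $ Cz)"
    by (rule DERIV_unique)
  then show "2 * rotX (central (p t)) (\<lambda>i. u $ Inl i) i = p t $ Cz * u $ Inr i"
    by (simp only: mult_2) (auto simp: algebra_simps eq_diff_eq)
  have "\<forall>\<^sub>F s in nhds t. p s $ Cy i = rotY (central (p s)) (\<lambda>j. x s $ Cy j) i"
    using ev by eventually_elim (use I(3) in \<open>auto simp: abnormal_constraint_cartan_iff\<close>)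
  from DERIV_cong_ev[OF refl this refl, THEN iffD1, OF py] DERIV_rotY[OF m y]
  have "- (p t $ Cz * u $ Inl i + rotY (central (p t)) (\<lambda>i. u $ Inr i) i) =
      rotY (central (p t)) (\<lambda>i. u $ Inr i) i"
    by (rule DERIV_unique)
  then show "2 * rotY (central (p t)) (\<lambda>i. u $ Inr i) i = - (p t $ Cz * u $ Inl i)"
    by (simp add: algebra_simps)
qed

section \<open>The null cone and straight singular curves\<close>

definition null_cone :: "(('a::comm_ring_1 ^ coord) \<times> ('a ^ coord)) set"
  where "null_cone =
    {(q, (\<Sum>i\<in>UNIV. u i *s X_field i q) + (\<Sum>j\<in>UNIV. v j *s Y_field j q)) |
      q u v. (\<Sum>i\<in>UNIV. u i * v i) = 0}"

lemma frame_combination_nth: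
  "((\<Sum>i\<in>UNIV. u i *s X_field i q) + (\<Sum>j\<in>UNIV. v j *s Y_field j q)) $ k =
    (\<Sum>i\<in>UNIV. (\<chi> i. case_sum u v i) $ i * cartan_frame i q $ k)"
  by (simp add: sum_Plus_UNIV cartan_frame_def)

text \<open>The coefficients of a horizontal vector are its own components along
  \<open>x\<^sub>i\<close> and \<open>y\<^sub>i\<close>, which removes the quantifiers over
  \<open>u\<close> and \<open>v\<close>.\<close>

lemma mem_null_cone_iff:
  "(q, w) \<in> null_cone \<longleftrightarrow> (\<Sum>i\<in>UNIV. w $ Cx i * w $ Cy i) = 0 \<and>
    (\<forall>k. w $ k = (\<Sum>i\<in>UNIV. w $ case_sum Cx Cy i * cartan_frame i q $ k))"
  (is "_ \<longleftrightarrow> ?R")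
proof
  assume "(q, w) \<in> null_cone"
  then obtain u v where uv: "(\<Sum>i\<in>UNIV. u i * v i) = 0"
    and w: "w = (\<Sum>i\<in>UNIV. u i *s X_field i q) + (\<Sum>j\<in>UNIV. v j *s Y_field j q)"
    by (auto simp: null_cone_def)
  have nth: "w $ k = (\<Sum>i\<in>UNIV. (\<chi> i. case_sum u v i) $ i * cartan_frame i q $ k)" for k
    unfolding w by (rule frame_combination_nth)
  have "w $ Cx j = u j" "w $ Cy j = v j" for j
    unfolding nth sum_cartan_frame_nth by simp_all
  then have "(\<Sum>i\<in>UNIV. w $ Cx i * w $ Cy i) = 0"
    and cs: "w $ case_sum Cx Cy i = (\<chi> i. case_sum u v i) $ i" for i
    using uv by (simp_all split: sum.split)
  then show ?R
    unfolding cs using nth by blast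
next
  assume R: ?R
  have cs: "(\<chi> i. case_sum (\<lambda>i. w $ Cx i) (\<lambda>i. w $ Cy i) i) $ i = w $ case_sum Cx Cy i" for i
    by (simp split: sum.split)
  have "w = (\<Sum>i\<in>UNIV. w $ Cx i *s X_field i q) + (\<Sum>j\<in>UNIV. w $ Cy j *s Y_field j q)"
    unfolding vec_eq_iff frame_combination_nth cs using R by blast
  from arg_cong[OF this, of "Pair q"] conjunct1[OF R] show "(q, w) \<in> null_cone"
    unfolding null_cone_def by (intro CollectI exI conjI)
qed

lemma abnormal_line:
  fixes q w :: "'a::real_normed_field ^ coord"
  assumes "(q, w) \<in> null_cone"
  obtains p u where "\<And>t. hamilton_at cartan_frame u (\<lambda>t. q + t *s w) (\<lambda>_. p) t"
    and "\<And>t. abnormal_constraint cartan_frame (q + t *s w) p"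
proof -
  have null: "(\<Sum>i\<in>UNIV. w $ Cx i * w $ Cy i) = 0"
    and w: "\<And>k. w $ k = (\<Sum>i\<in>UNIV. w $ case_sum Cx Cy i * cartan_frame i q $ k)"
    using assms unfolding mem_null_cone_iff by blast+
  obtain m c where m: "m c \<noteq> 0" "\<And>i. rotX m (\<lambda>i. w $ Cx i) i = 0" "\<And>i. rotY m (\<lambda>i. w $ Cy i) i = 0"
    by (rule ex_rot_kernel[OF null]) (rule that)
  \<comment> \<open>The constraint at \<open>q\<close> with \<open>\<lambda> = 0\<close> determines
    the rest of \<open>p\<close> from \<open>m\<close>. The same \<open>p\<close> works along the
    whole line, since \<open>A\<close> and \<open>B\<close> kill the direction of motion.\<close>
  define p :: "'a ^ coord" where "p = (\<chi> k. case k of Cz \<Rightarrow> 0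
    | Cx i \<Rightarrow> rotX m (\<lambda>i. q $ Cx i) i | Cy i \<Rightarrow> rotY m (\<lambda>i. q $ Cy i) i | Cxx c \<Rightarrow> m c)"
  define u :: "'a ^ (4 + 4)" where "u = (\<chi> i. w $ case_sum Cx Cy i)"
  have p: "p $ Cz = 0" "p $ Cx i = rotX m (\<lambda>i. q $ Cx i) i"
    "p $ Cy i = rotY m (\<lambda>i. q $ Cy i) i" "p $ Cxx c = m c" for i c
    by (simp_all add: p_def)
  have "abnormal_constraint cartan_frame (q + t *s w) p" for t
    using m by (auto simp: abnormal_constraint_cartan_iff p rotX_linear rotY_linear)
  moreover have vel: "(\<Sum>i\<in>UNIV. u $ i * cartan_frame i (q + t *s w) $ k) = w $ k" for t k
  proof (cases k)
    \<comment> \<open>Along the line the \<open>z\<close>-component changes by \<open>t\<close>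
      times \<open>u \<bullet> v\<close>, which is zero.\<close>
    case Cz
    have "(\<Sum>i\<in>UNIV. u $ i * cartan_frame i (q + t *s w) $ k) =
        (\<Sum>i\<in>UNIV. u $ i * cartan_frame i q $ k) + t * (\<Sum>i\<in>UNIV. w $ Cx i * w $ Cy i)"
      by (simp add: Cz sum_Plus_UNIV cartan_frame_def X_field_nth Y_field_nth u_def
          distrib_left sum.distrib sum_distrib_left mult_ac)
    then show ?thesis
      using w[of k] by (simp add: null u_def)
  next
    \<comment> \<open>The change in the \<open>x\<^sub>i\<^sub>j\<close>-component is
      \<open>t\<close> times antisymmetric expressions such as
      \<open>w\<^sub>a w\<^sub>b - w\<^sub>b w\<^sub>a\<close>, which vanish.\<close>
    case (Cxx c)
    obtain a b h l where "even_perm c = (a, b, h, l)"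
      by (cases "even_perm c")
    then have "(\<Sum>i\<in>UNIV. u $ i * cartan_frame i (q + t *s w) $ k) =
        (\<Sum>i\<in>UNIV. u $ i * cartan_frame i q $ k)"
      by (simp add: Cxx sum_Plus_UNIV cartan_frame_def X_field_nth Y_field_nth u_def
          right_diff_distrib sum_subtractf mult_delta_right) (simp add: algebra_simps)
    then show ?thesis
      using w[of k] by (simp add: u_def)
  qed (simp_all only: sum_cartan_frame_nth, simp_all add: u_def)
  have "hamilton_at cartan_frame u (\<lambda>t. q + t *s w) (\<lambda>_. p) t" for t
    unfolding hamilton_at_cartan_iff vel p
    using m by (auto intro!: derivative_eq_intros simp: u_def)
  ultimately show thesis
    by (rule that[rotated])
qed

text \<open>This settles the holomorphic case, where Hamilton's equations hold at the very point
  whose velocity is considered.\<close>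

lemma hamilton_null_velocity:
  fixes x :: "'a::real_normed_field \<Rightarrow> 'a ^ coord"
  assumes ham: "hamilton_at cartan_frame u x p t"
    and I: "open I" "t \<in> I" "\<And>s. s \<in> I \<Longrightarrow> abnormal_constraint cartan_frame (x s) (p s)"
    and w: "\<And>k. ((\<lambda>s. x s $ k) has_field_derivative w $ k) (at t)"
  shows "(x t, w) \<in> null_cone"
proof -
  have vel: "w $ k = (\<Sum>i\<in>UNIV. u $ i * cartan_frame i (x t) $ k)" for k
    using ham w DERIV_unique unfolding hamilton_at_cartan_iff by blast
  have u: "w $ Cx j = u $ Inl j" "w $ Cy j = u $ Inr j" for j
    unfolding vel sum_cartan_frame_nth by simp_all
  have cs: "w $ case_sum Cx Cy i = u $ i" for i
    by (cases i) (simp_all add: u)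
  have "p t $ Cz \<noteq> 0 \<or> (\<exists>c. p t $ Cxx c \<noteq> 0)"
    using I(3)[OF I(2)] unfolding abnormal_constraint_cartan_iff by blast
  with bicharacteristic_velocity_eqs[OF ham I] have "(\<Sum>i\<in>UNIV. w $ Cx i * w $ Cy i) = 0"
    unfolding u by (rule rot_eqs_imp_null[of "central (p t)" "\<lambda>i. u $ Inl i" "p t $ Cz" "\<lambda>i. u $ Inr i"])
  then show ?thesis
    unfolding mem_null_cone_iff cs using vel by blast
qed

lemma has_field_derivative_line:
  "((\<lambda>t. (q + t *s w) $ k) has_field_derivative w $ k) (at t)"
  by (auto intro!: derivative_eq_intros)

lemma SVC_complex_cartan_frame: "SVC_complex cartan_frame = null_cone"
proof (intro equalityI subrelI)
  fix q w :: "complex ^ coord"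
  assume "(q, w) \<in> SVC_complex cartan_frame"
  then obtain I \<gamma> p where "0 \<in> I" "abnormal_biextremal_complex cartan_frame I \<gamma> p" "\<gamma> 0 = q"
    "\<And>k. ((\<lambda>t. \<gamma> t $ k) has_field_derivative w $ k) (at 0)"
    by (auto simp: SVC_complex_def initial_velocities_def singular_curve_complex_def)
  then show "(q, w) \<in> null_cone"
    unfolding abnormal_biextremal_complex_def using hamilton_null_velocity[of _ \<gamma> p 0 I w] by blast
next
  fix q w :: "complex ^ coord"
  assume "(q, w) \<in> null_cone"
  then obtain p u where pu: "\<And>t. hamilton_at cartan_frame u (\<lambda>t. q + t *s w) (\<lambda>_. p) t"
    "\<And>t. abnormal_constraint cartan_frame (q + t *s w) p"
    by (rule abnormal_line) blast
  have "abnormal_biextremal_complex cartan_frame UNIV (\<lambda>t. q + t *s w) (\<lambda>_. p)"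
    unfolding abnormal_biextremal_complex_def using pu by (auto intro!: holomorphic_intros exI[of _ "\<lambda>_. u"])
  then show "(q, w) \<in> SVC_complex cartan_frame"
    unfolding SVC_complex_def initial_velocities_def singular_curve_complex_def
    using has_field_derivative_line[of q w _ 0]
    by (intro CollectI case_prodI exI[of _ UNIV] exI[of _ "\<lambda>t. q + t *s w"]) auto
qed

section \<open>Velocities of Lipschitz curves\<close>

lemma continuous_cartan_frame_nth:
  fixes x :: "'b::t2_space \<Rightarrow> 'a::real_normed_field ^ coord"
  assumes "continuous F x"
  shows "continuous F (\<lambda>t. cartan_frame i (x t) $ k)"
proof (cases k)
  case (Cxx c)
  obtain a b h l where "even_perm c = (a, b, h, l)"
    by (cases "even_perm c")
  then show ?thesis
    using assms by (cases i)
      (auto simp: Cxx cartan_frame_def X_field_nth Y_field_nth intro!: continuous_intros)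
qed (cases i; use assms in \<open>auto simp: cartan_frame_def X_field_nth Y_field_nth
    intro!: continuous_intros\<close>)+

text \<open>The hypothesis holds almost everywhere, possibly not at \<open>c\<close>, where the conclusion is drawn.\<close>

lemma lipschitz_horizontal_velocity:
  fixes x :: "real \<Rightarrow> real ^ coord"
  assumes lip: "L-lipschitz_on I x" and I: "open I" "c \<in> I"
    and hor: "AE t in lebesgue. t \<in> I \<longrightarrow> (\<exists>u :: real ^ (4 + 4).
      \<forall>k. ((\<lambda>s. x s $ k) has_field_derivative (\<Sum>i\<in>UNIV. u $ i * cartan_frame i (x t) $ k)) (at t))"
    and w: "\<And>k. ((\<lambda>s. x s $ k) has_field_derivative w $ k) (at c)"
  shows "w $ k = (\<Sum>i\<in>UNIV. w $ case_sum Cx Cy i * cartan_frame i (x c) $ k)"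
proof -
  \<comment> \<open>The frame is frozen at \<open>x c\<close>. The derivative of \<open>f\<close> at
    \<open>c\<close> is then the defect to be shown zero, and elsewhere it is the control applied to
    the difference of the frames at \<open>x t\<close> and \<open>x c\<close>.\<close>
  define f where "f t = x t $ k - (\<Sum>i\<in>UNIV. x t $ case_sum Cx Cy i * cartan_frame i (x c) $ k)" for t
  \<comment> \<open>The control is bounded by \<open>L\<close>, so \<open>e\<close> dominates the
    derivative of \<open>f\<close>; it tends to zero by continuity of the frame.\<close>
  define e where "e t = (\<Sum>i\<in>UNIV. L * \<bar>cartan_frame i (x t) $ k - cartan_frame i (x c) $ k\<bar>)" for t
  have "linear (\<lambda>q::real ^ coord. q $ k - (\<Sum>i\<in>UNIV. q $ case_sum Cx Cy i * cartan_frame i (x c) $ k))"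
    by (rule linearI)
      (simp_all add: sum.distrib distrib_right sum_distrib_left right_diff_distrib mult.assoc)
  then obtain K where K: "K-lipschitz_on I f"
    using lipschitz_on_linear[OF lip] unfolding f_def by blast
  have nth_lip: "L-lipschitz_on I (\<lambda>t. x t $ l)" for l
    using lip dist_vec_nth_le order_trans unfolding lipschitz_on_def by metis
  have small: "\<exists>D. (f has_real_derivative D) (at t) \<and> \<bar>D\<bar> \<le> e t"
    if "t \<in> I" and u: "\<And>k. ((\<lambda>s. x s $ k) has_field_derivative
      (\<Sum>i\<in>UNIV. u $ i * cartan_frame i (x t) $ k)) (at t)" for t and u :: "real ^ (4 + 4)"
  proof -
    have ui: "((\<lambda>s. x s $ case_sum Cx Cy i) has_field_derivative u $ i) (at t)" for i
      using u[of "case_sum Cx Cy i"] by (cases i) (simp_all add: sum_cartan_frame_nth)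
    let ?D = "(\<Sum>i\<in>UNIV. u $ i * cartan_frame i (x t) $ k) -
      (\<Sum>i\<in>UNIV. u $ i * cartan_frame i (x c) $ k)"
    have "(f has_real_derivative ?D) (at t)"
      unfolding f_def by (intro DERIV_diff u DERIV_sum DERIV_cmult_right ui)
    moreover have "\<bar>?D\<bar> \<le> e t"
    proof -
      have "?D = (\<Sum>i\<in>UNIV. u $ i * (cartan_frame i (x t) $ k - cartan_frame i (x c) $ k))"
        by (simp add: sum_subtractf right_diff_distrib)
      also have "\<bar>\<dots>\<bar> \<le> (\<Sum>i\<in>UNIV. \<bar>u $ i * (cartan_frame i (x t) $ k - cartan_frame i (x c) $ k)\<bar>)"
        by (rule sum_abs)
      also have "\<dots> \<le> e t"
        unfolding e_def abs_mult
        by (intro sum_mono mult_right_mono lipschitz_on_DERIV_bound[OF nth_lip I(1) \<open>t \<in> I\<close> ui]) simp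
      finally show ?thesis .
    qed
    ultimately show ?thesis by blast
  qed
  have "AE t in lebesgue. t \<in> I \<longrightarrow> (\<exists>D. (f has_real_derivative D) (at t) \<and> \<bar>D\<bar> \<le> e t)"
    using hor
  proof eventually_elim
    case (elim t)
    show ?case
    proof
      assume "t \<in> I"
      with elim obtain u :: "real ^ (4 + 4)" where
        "\<forall>k. ((\<lambda>s. x s $ k) has_field_derivative (\<Sum>i\<in>UNIV. u $ i * cartan_frame i (x t) $ k)) (at t)"
        by blast
      then show "\<exists>D. (f has_real_derivative D) (at t) \<and> \<bar>D\<bar> \<le> e t"
        by (intro small[OF \<open>t \<in> I\<close>]) (rule spec)
    qed
  qed
  moreover have "(e \<longlongrightarrow> 0) (at c)"
  proof -
    have "isCont x c"
      using lipschitz_on_continuous_on[OF lip] I continuous_on_eq_continuous_at by blast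
    then have "isCont e c"
      unfolding e_def by (intro continuous_intros continuous_cartan_frame_nth)
    then show ?thesis
      by (simp add: isCont_def e_def)
  qed
  moreover have "(f has_real_derivative
      w $ k - (\<Sum>i\<in>UNIV. w $ case_sum Cx Cy i * cartan_frame i (x c) $ k)) (at c)"
    unfolding f_def by (intro DERIV_diff w DERIV_sum DERIV_cmult_right)
  ultimately have "w $ k - (\<Sum>i\<in>UNIV. w $ case_sum Cx Cy i * cartan_frame i (x c) $ k) = 0"
    by (rule lipschitz_deriv_zero_if_AE_deriv_small[OF K I])
  then show ?thesis
    by (simp only: right_minus_eq)
qed

lemma lipschitz_null_velocity:
  fixes x p :: "real \<Rightarrow> real ^ coord"
  assumes lip: "L-lipschitz_on I x" "M-lipschitz_on I p"
    and I: "open I" "connected I" "c \<in> I"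
    and ham: "AE t in lebesgue. t \<in> I \<longrightarrow> hamilton_at cartan_frame (u t) x p t"
    and abn: "\<And>t. t \<in> I \<Longrightarrow> abnormal_constraint cartan_frame (x t) (p t)"
    and w: "\<And>k. ((\<lambda>s. x s $ k) has_field_derivative w $ k) (at c)"
  shows "(x c, w) \<in> null_cone"
proof -
  have p_lip: "M-lipschitz_on I (\<lambda>t. p t $ l)" for l
    using lip(2) dist_vec_nth_le order_trans unfolding lipschitz_on_def by metis
  have z: "p t $ Cz = p c $ Cz" if "t \<in> I" for t
  proof (rule lipschitz_AE_deriv_zero_imp_const[OF p_lip I(2) _ that I(3)])
    show "AE t in lebesgue. t \<in> I \<longrightarrow> ((\<lambda>t. p t $ Cz) has_real_derivative 0) (at t)"
      using ham by eventually_elim (simp add: hamilton_at_cartan_iff)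
  qed
  have m: "p t $ Cxx d = p c $ Cxx d" if "t \<in> I" for t d
  proof (rule lipschitz_AE_deriv_zero_imp_const[OF p_lip I(2) _ that I(3)])
    show "AE t in lebesgue. t \<in> I \<longrightarrow> ((\<lambda>t. p t $ Cxx d) has_real_derivative 0) (at t)"
      using ham by eventually_elim (simp add: hamilton_at_cartan_iff)
  qed
  let ?l = "p c $ Cz" and ?m = "central (p c)"
  \<comment> \<open>With \<open>\<lambda>\<close> and \<open>A\<close> frozen at their constant
    values, \<open>F\<close> and \<open>G\<close> are linear in the point, so differentiating them
    along the curve evaluates them at the velocity.\<close>
  define F where "F i q = 2 * rotX ?m (\<lambda>j. q $ Cx j) i - ?l * q $ Cy i" for i and q :: "real ^ coord"
  define G where "G i q = 2 * rotY ?m (\<lambda>j. q $ Cy j) i + ?l * q $ Cx i" for i and q :: "real ^ coord"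
  have linear: "linear (F i)" "linear (G i)" for i
    unfolding F_def G_def by (auto intro!: linearI simp: rotX_linear rotY_linear algebra_simps)
  have DERIV_F: "((\<lambda>s. F i (x s)) has_field_derivative F i v) (at t)"
    and DERIV_G: "((\<lambda>s. G i (x s)) has_field_derivative G i v) (at t)"
    if "\<And>k. ((\<lambda>s. x s $ k) has_field_derivative v $ k) (at t)" for i v t
    unfolding F_def G_def
    by (intro DERIV_diff DERIV_add DERIV_cmult DERIV_rotX DERIV_rotY DERIV_const that)+
  have vanish: "((\<lambda>s. F i (x s)) has_field_derivative 0) (at t)"
      "((\<lambda>s. G i (x s)) has_field_derivative 0) (at t)"
    if "t \<in> I" and H: "hamilton_at cartan_frame (u t) x p t" for i t
  proof -
    define v where "v = (\<chi> k. \<Sum>i\<in>UNIV. u t $ i * cartan_frame i (x t) $ k)"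
    have v: "((\<lambda>s. x s $ k) has_field_derivative v $ k) (at t)" for k
      using H by (simp add: hamilton_at_cartan_iff v_def)
    have "v $ Cx i = u t $ Inl i" "v $ Cy i = u t $ Inr i" for i
      by (simp_all add: v_def sum_cartan_frame_nth)
    then have "F i v = 0" "G i v = 0" for i
      using bicharacteristic_velocity_eqs[OF H I(1) \<open>t \<in> I\<close> abn] z[OF \<open>t \<in> I\<close>] m[OF \<open>t \<in> I\<close>]
      by (simp_all add: F_def G_def)
    then show "((\<lambda>s. F i (x s)) has_field_derivative 0) (at t)"
      "((\<lambda>s. G i (x s)) has_field_derivative 0) (at t)"
      using DERIV_F[OF v] DERIV_G[OF v] by metis+
  qed
  \<comment> \<open>The bound on the derivative is \<open>0\<close> almost everywhere, hence the
    derivative \<open>f w\<close> at \<open>c\<close> vanishes even if Hamilton's equations fail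
    there.\<close>
  have zero: "f w = 0"
    if "linear f" and AE: "AE t in lebesgue. t \<in> I \<longrightarrow> ((\<lambda>s. f (x s)) has_field_derivative 0) (at t)"
      and D: "((\<lambda>s. f (x s)) has_field_derivative f w) (at c)" for f :: "real ^ coord \<Rightarrow> real"
  proof -
    obtain K where K: "K-lipschitz_on I (\<lambda>t. f (x t))"
      using lipschitz_on_linear[OF lip(1) \<open>linear f\<close>] by blast
    have "AE t in lebesgue. t \<in> I \<longrightarrow>
        (\<exists>D. ((\<lambda>s. f (x s)) has_real_derivative D) (at t) \<and> \<bar>D\<bar> \<le> 0)"
      using AE by eventually_elim auto
    from lipschitz_deriv_zero_if_AE_deriv_small[OF K I(1,3) this tendsto_const D]
    show ?thesis .
  qed
  have "F i w = 0" for i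
  proof (intro zero linear DERIV_F w)
    show "AE t in lebesgue. t \<in> I \<longrightarrow> ((\<lambda>s. F i (x s)) has_field_derivative 0) (at t)"
      using ham by eventually_elim (use vanish in blast)
  qed
  moreover have "G i w = 0" for i
  proof (intro zero linear DERIV_G w)
    show "AE t in lebesgue. t \<in> I \<longrightarrow> ((\<lambda>s. G i (x s)) has_field_derivative 0) (at t)"
      using ham by eventually_elim (use vanish in blast)
  qed
  moreover have "?l \<noteq> 0 \<or> (\<exists>d. ?m d \<noteq> 0)"
    using abn[OF I(3)] unfolding abnormal_constraint_cartan_iff by blast
  ultimately have "(\<Sum>i\<in>UNIV. w $ Cx i * w $ Cy i) = 0"
    by (intro rot_eqs_imp_null[of ?m "\<lambda>i. w $ Cx i" ?l]) (simp_all add: F_def G_def eq_neg_iff_add_eq_0)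
  moreover have "AE t in lebesgue. t \<in> I \<longrightarrow> (\<exists>u :: real ^ (4 + 4).
      \<forall>k. ((\<lambda>s. x s $ k) has_field_derivative (\<Sum>i\<in>UNIV. u $ i * cartan_frame i (x t) $ k)) (at t))"
    using ham by eventually_elim (unfold hamilton_at_cartan_iff, blast)
  ultimately show ?thesis
    unfolding mem_null_cone_iff using lipschitz_horizontal_velocity[OF lip(1) I(1,3) _ w] by blast
qed

lemma SVC_real_cartan_frame: "SVC_real cartan_frame = null_cone"
proof (intro equalityI subrelI)
  fix q w :: "real ^ coord"
  assume "(q, w) \<in> SVC_real cartan_frame"
  then obtain I \<gamma> p where "0 \<in> I" "abnormal_biextremal_real cartan_frame I \<gamma> p" "\<gamma> 0 = q"
    "\<And>k. ((\<lambda>t. \<gamma> t $ k) has_field_derivative w $ k) (at 0)"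
    by (auto simp: SVC_real_def initial_velocities_def singular_curve_real_def)
  then show "(q, w) \<in> null_cone"
    unfolding abnormal_biextremal_real_def using lipschitz_null_velocity[of _ I \<gamma> _ p 0 _ w] by blast
next
  fix q w :: "real ^ coord"
  assume "(q, w) \<in> null_cone"
  then obtain p u where pu: "\<And>t. hamilton_at cartan_frame u (\<lambda>t. q + t *s w) (\<lambda>_. p) t"
    "\<And>t. abnormal_constraint cartan_frame (q + t *s w) p"
    by (rule abnormal_line) blast
  have "(norm w)-lipschitz_on UNIV (\<lambda>t. q + t *s w)"
    by (intro lipschitz_onI)
      (simp_all add: scalar_mult_eq_scaleR dist_norm scaleR_diff_left[symmetric] mult.commute)
  then have "abnormal_biextremal_real cartan_frame UNIV (\<lambda>t. q + t *s w) (\<lambda>_. p)"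
    unfolding abnormal_biextremal_real_def using pu
    by (auto intro: lipschitz_on_constant exI[of _ 0] exI[of _ "\<lambda>_. u"])
  then show "(q, w) \<in> SVC_real cartan_frame"
    unfolding SVC_real_def initial_velocities_def singular_curve_real_def
    using has_field_derivative_line[of q w _ 0]
    by (intro CollectI case_prodI exI[of _ UNIV] exI[of _ "\<lambda>t. q + t *s w"]) auto
qed

theorem proposition4p2:
  shows "SVC_real cartan_frame =
      {(q, (\<Sum>i\<in>UNIV. u i *s X_field i q) + (\<Sum>j\<in>UNIV. v j *s Y_field j q)) |
        (q :: real ^ coord) u v. (\<Sum>i\<in>UNIV. u i * v i) = 0} \<and>
    SVC_complex cartan_frame =
      {(q, (\<Sum>i\<in>UNIV. u i *s X_field i q) + (\<Sum>j\<in>UNIV. v j *s Y_field j q)) |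
        (q :: complex ^ coord) u v. (\<Sum>i\<in>UNIV. u i * v i) = 0}"
  using SVC_real_cartan_frame SVC_complex_cartan_frame unfolding null_cone_def by (rule conjI)

end
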